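(* Let $MZ1$ denote the first multiplicative Zagreb index of a tree, and write $MZ1(n)=MZ1(\tau(n))$, where $\tau(n)$ is the rooted tree with Matula number $n$. Then for every positive integer $n$, $$MZ1(n)=\begin{cases}0, & \text{if } n=1;\\ 1, & \text{if } n=2;\\ MZ1(t)\left(1+\frac{1}{\Omega(t)}\right)^2, & \text{if } n=p_t \text{ with } t\ge 2;\\ MZ1(r)MZ1(s)\left(\frac{1}{\Omega(r)}+\frac{1}{\Omega(s)}\right)^2, & \text{if } n=rs \text{ with } r,s\ge 2.\end{cases}$$
   Context: For $m\ge 1$ let $p_m$ denote the $m$-th prime ($p_1=2,p_2=3,p_3=5,\dots$). For a positive integer $n$, $\Omega(n)$ is the number of prime divisors of $n$ counted with multiplicity. Rooted trees are finite and considered up to isomorphism of rooted trees. The Matula number $\mu(T)$ of a rooted tree $T$ is defined recursively: $\mu(T)=1$ for the one-vertex tree; otherwise, if $T_1,\dots,T_d$ are the subtrees rooted at the vertices adjacent to the root of $T$, then $\mu(T)=p_{\mu(T_1)}p_{\mu(T_2)}\cdots p_{\mu(T_d)}$. The map $\mu$ is a bijection from rooted trees to positive integers, and $\tau(n)$ denotes the rooted tree with Matula number $n$. Equivalently: $\tau(1)$ is the one-vertex tree; $\tau(p_t)$ is obtained from $\tau(t)$ by adding a new vertex, which becomes the root, joined by an edge to the root of $\tau(t)$; and, for $r,s\ge 2$, $\tau(rs)$ is obtained from $\tau(r)$ and $\tau(s)$ by identifying their roots. For a statistic $S$ on rooted trees, $S(n)$ means $S(\tau(n))$. The degree $\deg(i)$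 of a vertex $i$ is the number of edges incident with $i$. The first multiplicative Zagreb index of a tree is $\prod_i \deg(i)^2$, the product being over all vertices $i$. *)

theory Defs
  imports Complex_Main "HOL-Library.Infinite_Set" "HOL-Computational_Algebra.Primes"
begin

(* The m-th prime for m \<ge> 1, counted from nth_prime 1 = 2.  The value at 0 is junk. *)
definition nth_prime :: "nat \<Rightarrow> nat" where
  "nth_prime m = enumerate {p. prime p} (m - 1)"

definition Omega :: "nat \<Rightarrow> nat" where
  "Omega n = size (prime_factorization n)"

record 'v rooted_graph =
  verts :: "'v set"
  edges :: "'v set set"
  root_of :: 'v

definition adj :: "'v set set \<Rightarrow> ('v \<times> 'v) set" where
  "adj E = {(u, v). {u, v} \<in> E}"

definition cycle :: "'v set set \<Rightarrow> 'v list \<Rightarrow> bool" where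
  "cycle E vs \<longleftrightarrow> length vs \<ge> 3 \<and> distinct vs \<and>
     successively (\<lambda>u v. {u, v} \<in> E) vs \<and> {last vs, hd vs} \<in> E"

definition rooted_tree :: "'v rooted_graph \<Rightarrow> bool" where
  "rooted_tree T \<longleftrightarrow>
     finite (verts T) \<and> root_of T \<in> verts T \<and>
     (\<forall>e \<in> edges T. e \<subseteq> verts T \<and> card e = 2) \<and>
     (\<forall>u \<in> verts T. \<forall>v \<in> verts T. (u, v) \<in> (adj (edges T))\<^sup>*) \<and>
     (\<nexists>vs. cycle (edges T) vs)"

definition degree :: "'v rooted_graph \<Rightarrow> 'v \<Rightarrow> nat" where
  "degree T v = card {e \<in> edges T. v \<in> e}"

definition root_nbrs :: "'v rooted_graph \<Rightarrow> 'v set" where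
  "root_nbrs T = {c. {root_of T, c} \<in> edges T}"

(* The subtree rooted at the neighbour c of the root: the component of c after deletion
   of the root. *)
definition branch :: "'v rooted_graph \<Rightarrow> 'v \<Rightarrow> 'v rooted_graph" where
  "branch T c =
     (let V = {v. (c, v) \<in> (adj {e \<in> edges T. root_of T \<notin> e})\<^sup>*}
      in \<lparr>verts = V, edges = {e \<in> edges T. e \<subseteq> V}, root_of = c\<rparr>)"

lemma verts_branch_psubset:
  assumes T: "rooted_tree T" and c: "c \<in> root_nbrs T"
  shows "verts (branch T c) \<subset> verts T"
proof -
  have edge: "u \<noteq> v \<and> u \<in> verts T \<and> v \<in> verts T" if "{u, v} \<in> edges T" for u v
    using T that by (auto simp: rooted_tree_def)
  have c': "c \<in> verts T - {root_of T}"
    using edge[of "root_of T" c] c by (auto simp: root_nbrs_def)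
  have "v \<in> verts T - {root_of T}"
    if "(c, v) \<in> (adj {e \<in> edges T. root_of T \<notin> e})\<^sup>*" for v
    using that c' by (induction rule: rtrancl_induct) (auto simp: adj_def dest: edge)
  then have "verts (branch T c) \<subseteq> verts T - {root_of T}"
    by (auto simp: branch_def Let_def)
  moreover have "root_of T \<in> verts T"
    using T by (simp add: rooted_tree_def)
  ultimately show ?thesis by blast
qed

(* For the one-vertex tree the product is empty, so its Matula number is 1.  The value 0
   outside rooted trees only makes the function total. *)
function matula :: "'v rooted_graph \<Rightarrow> nat" where
  "matula T = (if rooted_tree T
     then \<Prod>c \<in> root_nbrs T. nth_prime (matula (branch T c)) else 0)"
  by pat_completeness auto
termination
proof (relation "measure (\<lambda>T. card (verts T))")
  fix T :: "'v rooted_graph" and c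
  assume T: "rooted_tree T" and c: "c \<in> root_nbrs T"
  have "finite (verts T)"
    using T by (simp add: rooted_tree_def)
  then have "card (verts (branch T c)) < card (verts T)"
    using verts_branch_psubset[OF T c] by (rule psubset_card_mono)
  then show "(branch T c, T) \<in> measure (\<lambda>T. card (verts T))"
    by simp
qed simp

declare matula.simps [simp del]

(* The Matula number determines a rooted tree up to isomorphism, so the tree with number n
   is represented by an arbitrary one with vertices in nat; every finite rooted tree has an
   isomorphic copy there. *)
definition tau :: "nat \<Rightarrow> nat rooted_graph" where
  "tau n = (SOME T. rooted_tree T \<and> matula T = n)"

definition MZ1_tree :: "'v rooted_graph \<Rightarrow> nat" where
  "MZ1_tree T = (\<Prod>v \<in> verts T. (degree T v)\<^sup>2)"

definition MZ1 :: "nat \<Rightarrow> real" where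
  "MZ1 n = real (MZ1_tree (tau n))"

end

theory Submission imports Defs begin

text \<open>
  Delete the root of a tree \<open>T\<close> with Matula number \<open>n\<close>. The other vertices fall apart into the
  branches, one for each neighbour \<open>c\<close> of the root, and a vertex keeps its degree in its branch,
  except that \<open>c\<close> loses one. The root itself has as many neighbours as \<open>n\<close> has prime
  factors, so its degree is \<open>\<Omega>(n)\<close>, and by the same token \<open>c\<close> has degree \<open>\<Omega>(t) + 1\<close> in \<open>T\<close>,
  where \<open>t\<close> is the Matula number of its branch. Hence the product \<open>P\<close> of the squared degrees of
  the vertices other than the root depends on \<open>n\<close> only, through the recursion
  \<open>P(n) = \<Prod> (\<Omega>(t) + 1)\<^sup>2 P(t)\<close> over the prime factors \<open>p\<^sub>t\<close> of \<open>n\<close> with multiplicity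
  (\<open>nonroot_product\<close>, \<open>prod_nonroot_degrees\<close>), and
  \<open>MZ1(n) = \<Omega>(n)\<^sup>2 P(n)\<close>. Now \<open>P\<close> is completely multiplicative with
  \<open>P(p\<^sub>t) = (\<Omega>(t) + 1)\<^sup>2 P(t)\<close>, and \<open>\<Omega>\<close> is completely additive, so the claimed
  formulas follow after division by the factors \<open>\<Omega>(t)\<^sup>2\<close>, or \<open>\<Omega>(r)\<^sup>2 \<Omega>(s)\<^sup>2\<close>, which are nonzero
  for arguments at least 2.

  The index being computed from the Matula number alone, every choice of \<open>tau n\<close> gives the same
  value, and what remains is that there is something to choose (\<open>ex_rooted_tree_matula\<close>): a tree
  with Matula number \<open>m p\<^sub>t\<close> arises from disjoint trees with numbers \<open>m\<close> and \<open>t\<close> by joining their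
  roots by an edge.
\<close>

section \<open>Indices of primes and the arithmetic recursion\<close>

lemma prime_nth_prime: "prime (nth_prime m)"
  using enumerate_in_set[OF primes_infinite] by (simp add: nth_prime_def)

lemma inj_on_nth_prime: "inj_on nth_prime {1..}"
proof (rule inj_onI)
  fix s t :: nat
  assume s: "s \<in> {1..}" and t: "t \<in> {1..}" and "nth_prime s = nth_prime t"
  then have "s - 1 = t - 1"
    using strict_mono_enumerate[OF primes_infinite, THEN strict_mono_eq]
    by (simp add: nth_prime_def)
  then show "s = t"
    using s t by auto
qed

text \<open>The recursions on Matula numbers terminate because of this strict inequality.\<close>

lemma less_nth_prime: "m < nth_prime m"
proof -
  have "k + 2 \<le> enumerate {p::nat. prime p} k" for k
  proof (induction k)
    case 0
    show ?case
      using prime_ge_2_nat[of "enumerate {p. prime p} 0"] enumerate_in_set[OF primes_infinite, of 0]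
      by simp
  next
    case (Suc k)
    then show ?case
      using enumerate_step[OF primes_infinite, of k] by simp
  qed
  from this[of "m - 1"] show ?thesis
    by (simp add: nth_prime_def)
qed

lemma prime_is_nth_prime:
  assumes "prime p"
  obtains t where "t \<ge> 1" "p = nth_prime t"
proof -
  obtain k where "enumerate {p::nat. prime p} k = p"
    using enumerate_Ex[of "{p::nat. prime p}" p] primes_infinite assms by auto
  then have "p = nth_prime (Suc k)"
    by (simp add: nth_prime_def)
  then show thesis
    using that[of "Suc k"] by simp
qed

definition prime_index :: "nat \<Rightarrow> nat" where
  "prime_index = inv_into {1..} nth_prime"

lemma prime_index_nth_prime: "t \<ge> 1 \<Longrightarrow> prime_index (nth_prime t) = t"
  unfolding prime_index_def by (rule inv_into_f_f[OF inj_on_nth_prime]) simp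

lemma prime_index_less:
  assumes "p \<in># prime_factorization n"
  shows "prime_index p < n"
proof -
  have "prime p" and "p dvd n" and "n \<noteq> 0"
    using assms by (auto simp: in_prime_factors_iff)
  obtain t where t: "t \<ge> 1" "p = nth_prime t"
    using \<open>prime p\<close> by (rule prime_is_nth_prime)
  have "prime_index p = t"
    using t by (simp add: prime_index_nth_prime)
  also have "t < p"
    using t less_nth_prime by simp
  also have "p \<le> n"
    using \<open>p dvd n\<close> \<open>n \<noteq> 0\<close> by (intro dvd_imp_le) auto
  finally show ?thesis .
qed

text \<open>For the tree with Matula number \<open>n\<close>, this is the product of the squared degrees of
  all vertices except the root. Leaving the root out makes the function multiplicative.\<close>

function nonroot_product :: "nat \<Rightarrow> nat" where
  "nonroot_product n = (\<Prod>p\<in>#prime_factorization n.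
     (Omega (prime_index p) + 1)\<^sup>2 * nonroot_product (prime_index p))"
  by pat_completeness auto
termination
  by (relation "measure id") (auto intro: prime_index_less simp del: in_prime_factors_iff)

declare nonroot_product.simps [simp del]

lemma nonroot_product_1: "nonroot_product 1 = 1"
  by (subst nonroot_product.simps) simp

lemma nonroot_product_nth_prime:
  assumes "t \<ge> 1"
  shows "nonroot_product (nth_prime t) = (Omega t + 1)\<^sup>2 * nonroot_product t"
  using assms
  by (simp add: nonroot_product.simps[of "nth_prime t"] prime_factorization_prime
      prime_nth_prime prime_index_nth_prime)

lemma nonroot_product_mult:
  assumes "r \<noteq> 0" "s \<noteq> 0"
  shows "nonroot_product (r * s) = nonroot_product r * nonroot_product s"
  using assms
  by (simp add: nonroot_product.simps[of "r * s"] nonroot_product.simps[of r]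
      nonroot_product.simps[of s] prime_factorization_mult)

lemma Omega_nth_prime: "Omega (nth_prime t) = 1"
  by (simp add: Omega_def prime_factorization_prime prime_nth_prime)

lemma Omega_mult: "r \<noteq> 0 \<Longrightarrow> s \<noteq> 0 \<Longrightarrow> Omega (r * s) = Omega r + Omega s"
  by (simp add: Omega_def prime_factorization_mult)

lemma Omega_pos:
  assumes "n \<ge> 2"
  shows "Omega n > 0"
proof -
  have "prime_factorization n \<noteq> {#}"
    using assms by (simp add: prime_factorization_empty_iff)
  then show ?thesis
    unfolding Omega_def by (metis nonempty_has_size)
qed

section \<open>Paths in edge sets\<close>

lemma adj_iff: "(u, v) \<in> adj E \<longleftrightarrow> {u, v} \<in> E"
  by (simp add: adj_def)

lemma sym_adj_rtrancl: "sym ((adj E)\<^sup>*)"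
  by (rule sym_rtrancl) (auto simp: sym_def adj_iff insert_commute)

lemma adj_rtrancl_sym: "(u, v) \<in> (adj E)\<^sup>* \<Longrightarrow> (v, u) \<in> (adj E)\<^sup>*"
  using sym_adj_rtrancl by (rule symD)

lemma adj_rtrancl_from_common:
  "(w, u) \<in> (adj E)\<^sup>* \<Longrightarrow> (w, v) \<in> (adj E)\<^sup>* \<Longrightarrow> (u, v) \<in> (adj E)\<^sup>*"
  by (rule rtrancl_trans[OF adj_rtrancl_sym])

lemma adj_rtrancl_mono: "E \<subseteq> F \<Longrightarrow> (u, v) \<in> (adj E)\<^sup>* \<Longrightarrow> (u, v) \<in> (adj F)\<^sup>*"
  by (rule rtrancl_mono[THEN subsetD, of "adj E"]) (auto simp: adj_def)

lemma cycle_mono: "cycle E vs \<Longrightarrow> E \<subseteq> F \<Longrightarrow> cycle F vs"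
  by (auto simp: cycle_def elim!: successively_mono)

text \<open>It allows a cycle through a given vertex to be started there, so that what remains is a path which
  avoids that vertex.\<close>

lemma cycle_rotate:
  assumes "cycle E (xs @ ys)"
  shows "cycle E (ys @ xs)"
  using assms
  by (cases "xs = []"; cases "ys = []") (auto simp: cycle_def successively_append_iff)

text \<open>Cycles are lists without repetition, whereas connectivity is a reflexive transitive closure; this
  is the bridge between the two. A walk that comes back to one of its earlier vertices is cut off
  there.\<close>

lemma rtrancl_adj_simple_path:
  assumes "(u, v) \<in> (adj E)\<^sup>*"
  obtains vs where "vs \<noteq> []" "hd vs = u" "last vs = v" "distinct vs"
    "successively (\<lambda>x y. {x, y} \<in> E) vs" "set vs \<subseteq> insert u (\<Union>E)"
proof -
  have "\<exists>vs. vs \<noteq> [] \<and> hd vs = u \<and> last vs = v \<and> distinct vs \<and>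
      successively (\<lambda>x y. {x, y} \<in> E) vs \<and> set vs \<subseteq> insert u (\<Union>E)"
    using assms
  proof (induction rule: rtrancl_induct)
    case base
    show ?case by (rule exI[of _ "[u]"]) simp
  next
    case (step y z)
    then obtain vs where vs: "vs \<noteq> []" "hd vs = u" "last vs = y" "distinct vs"
      "successively (\<lambda>x y. {x, y} \<in> E) vs" "set vs \<subseteq> insert u (\<Union>E)"
      by blast
    show ?case
    proof (cases "z \<in> set vs")
      case True
      then obtain xs ys where split: "vs = xs @ z # ys"
        by (meson split_list)
      have "hd (xs @ [z]) = u"
        using vs(2) split by (cases xs) auto
      then show ?thesis
        using vs split
        by (intro exI[of _ "xs @ [z]"]) (auto simp: successively_append_iff)
    next
      case False
      have "{y, z} \<in> E"
        using step.hyps by (simp add: adj_iff)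
      then show ?thesis
        using vs False
        by (intro exI[of _ "vs @ [z]"]) (auto simp: successively_append_iff)
    qed
  qed
  then show thesis
    using that by blast
qed

text \<open>The edges in \<open>F\<close> do not touch \<open>A\<close> and those in \<open>E\<close> do not
  leave it, so no walk from inside can use \<open>F\<close>.\<close>

lemma rtrancl_adj_Un_disjoint:
  assumes "(u, v) \<in> (adj (E \<union> F))\<^sup>*" and "u \<in> A"
    and "\<Union>E \<subseteq> A" and "A \<inter> \<Union>F = {}"
  shows "(u, v) \<in> (adj E)\<^sup>* \<and> v \<in> A"
  using assms(1)
proof (induction rule: rtrancl_induct)
  case base
  then show ?case using assms(2) by simp
next
  case (step y z)
  have "{y, z} \<notin> F"
    using step.IH assms(4) by blast
  then have "{y, z} \<in> E"
    using step.hyps by (simp add: adj_iff)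
  then show ?case
    using step.IH assms(3) by (auto simp: adj_iff intro: rtrancl_into_rtrancl)
qed

section \<open>Branches of a rooted tree\<close>

lemma rooted_tree_edgeD:
  assumes "rooted_tree T" "{u, v} \<in> edges T"
  shows "u \<noteq> v" "u \<in> verts T" "v \<in> verts T"
  using assms by (auto simp: rooted_tree_def)

lemma rooted_tree_edgeE:
  assumes "rooted_tree T" "e \<in> edges T" "v \<in> e"
  obtains w where "e = {v, w}" "v \<noteq> w"
proof -
  have "card e = 2"
    using assms by (simp add: rooted_tree_def)
  then show thesis
    using assms(3) that by (auto simp: card_2_iff insert_commute)
qed

lemma Union_edges_subset: "rooted_tree T \<Longrightarrow> \<Union>(edges T) \<subseteq> verts T"
  by (auto simp: rooted_tree_def)

lemma finite_edges: "rooted_tree T \<Longrightarrow> finite (edges T)"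
  by (rule finite_subset[of _ "Pow (verts T)"]) (auto simp: rooted_tree_def)

lemma finite_root_nbrs:
  assumes "rooted_tree T"
  shows "finite (root_nbrs T)"
proof (rule finite_subset)
  show "root_nbrs T \<subseteq> verts T"
    using rooted_tree_edgeD[OF assms] by (auto simp: root_nbrs_def)
  show "finite (verts T)"
    using assms by (simp add: rooted_tree_def)
qed

lemma root_notin_root_nbrs: "rooted_tree T \<Longrightarrow> root_of T \<notin> root_nbrs T"
  using rooted_tree_edgeD(1) by (force simp: root_nbrs_def)

lemma verts_branch:
  "verts (branch T c) = {v. (c, v) \<in> (adj {e \<in> edges T. root_of T \<notin> e})\<^sup>*}"
  by (simp add: branch_def Let_def)

lemma root_of_branch [simp]: "root_of (branch T c) = c"
  by (simp add: branch_def Let_def)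

lemma edges_branch: "edges (branch T c) = {e \<in> edges T. e \<subseteq> verts (branch T c)}"
  by (simp add: branch_def Let_def)

lemma self_in_branch: "c \<in> verts (branch T c)"
  by (simp add: verts_branch)

lemma root_notin_branch:
  assumes "rooted_tree T" "c \<in> root_nbrs T"
  shows "root_of T \<notin> verts (branch T c)"
proof
  assume "root_of T \<in> verts (branch T c)"
  then have "(c, root_of T) \<in> (adj {e \<in> edges T. root_of T \<notin> e})\<^sup>*"
    by (simp add: verts_branch)
  then show False
    by (cases rule: rtranclE)
      (use assms root_notin_root_nbrs in \<open>auto simp: adj_iff\<close>)
qed

lemma branch_edge_closed:
  assumes "v \<in> verts (branch T c)" "{v, w} \<in> edges T" "v \<noteq> root_of T" "w \<noteq> root_of T"
  shows "w \<in> verts (branch T c)"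
  using assms by (auto simp: verts_branch adj_iff intro: rtrancl_into_rtrancl)

lemma rooted_tree_branch:
  assumes T: "rooted_tree T" and c: "c \<in> root_nbrs T"
  shows "rooted_tree (branch T c)"
proof -
  let ?B = "branch T c"
  have reach: "(c, v) \<in> (adj (edges ?B))\<^sup>*"
    if "(c, v) \<in> (adj {e \<in> edges T. root_of T \<notin> e})\<^sup>*" for v
    using that
  proof (induction rule: rtrancl_induct)
    case (step y z)
    have "y \<in> verts ?B" "z \<in> verts ?B"
      using step.hyps by (auto simp: verts_branch intro: rtrancl_into_rtrancl)
    then have "(y, z) \<in> adj (edges ?B)"
      using step.hyps by (simp add: adj_iff edges_branch)
    then show ?case
      using step.IH by (rule rtrancl_into_rtrancl[rotated])
  qed simp
  have "(u, v) \<in> (adj (edges ?B))\<^sup>*" if "u \<in> verts ?B" "v \<in> verts ?B" for u v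
    using that by (intro adj_rtrancl_from_common[OF reach reach]) (simp_all add: verts_branch)
  moreover have "finite (verts ?B)"
    using T verts_branch_psubset[OF T c] by (meson finite_subset psubset_imp_subset rooted_tree_def)
  moreover have "\<nexists>vs. cycle (edges ?B) vs"
    using T cycle_mono[of "edges ?B" _ "edges T"] by (auto simp: rooted_tree_def edges_branch)
  ultimately show ?thesis
    using T self_in_branch[of c T] by (auto simp: rooted_tree_def edges_branch)
qed

text \<open>A vertex shared by the branches of two distinct neighbours \<open>c\<close> and \<open>d\<close>
  of the root would give a path from \<open>c\<close> to \<open>d\<close> that avoids the root, and the root
  would close it to a cycle.\<close>

lemma branch_disjoint:
  assumes T: "rooted_tree T" and c: "c \<in> root_nbrs T" and d: "d \<in> root_nbrs T"
    and v: "v \<in> verts (branch T c)" "v \<in> verts (branch T d)"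
  shows "c = d"
proof (rule ccontr)
  assume "c \<noteq> d"
  let ?F = "{e \<in> edges T. root_of T \<notin> e}"
  have "(c, v) \<in> (adj ?F)\<^sup>*" "(d, v) \<in> (adj ?F)\<^sup>*"
    using v by (simp_all add: verts_branch)
  then have "(c, d) \<in> (adj ?F)\<^sup>*"
    by (rule rtrancl_trans[OF _ adj_rtrancl_sym])
  then obtain vs where vs: "vs \<noteq> []" "hd vs = c" "last vs = d" "distinct vs"
    "successively (\<lambda>x y. {x, y} \<in> ?F) vs" "set vs \<subseteq> insert c (\<Union>?F)"
    by (rule rtrancl_adj_simple_path)
  have "root_of T \<notin> set vs"
    using vs(6) root_notin_root_nbrs[OF T] c by auto
  moreover have "length vs \<ge> 2"
    using vs(1-3) \<open>c \<noteq> d\<close> by (cases vs rule: remdups_adj.cases) auto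
  moreover have "successively (\<lambda>x y. {x, y} \<in> edges T) vs"
    using vs(5) by (rule successively_mono) auto
  ultimately have "cycle (edges T) (root_of T # vs)"
    using vs c d by (auto simp: cycle_def successively_Cons root_nbrs_def insert_commute)
  then show False
    using T by (auto simp: rooted_tree_def)
qed

text \<open>A walk from the root to another vertex lies, after its last visit to the root, within one
  branch.\<close>

lemma nonroot_verts_eq_Union_branches:
  assumes T: "rooted_tree T"
  shows "verts T - {root_of T} = (\<Union>c\<in>root_nbrs T. verts (branch T c))"
proof
  show "(\<Union>c\<in>root_nbrs T. verts (branch T c)) \<subseteq> verts T - {root_of T}"
  proof (rule UN_least)
    fix c
    assume "c \<in> root_nbrs T"
    then show "verts (branch T c) \<subseteq> verts T - {root_of T}"
      using verts_branch_psubset[OF T, of c] root_notin_branch[OF T, of c] by auto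
  qed
  have reach: "v = root_of T \<or> (\<exists>c\<in>root_nbrs T. v \<in> verts (branch T c))"
    if "(root_of T, v) \<in> (adj (edges T))\<^sup>*" for v
    using that
  proof (induction rule: rtrancl_induct)
    case (step y z)
    show ?case
    proof (cases "y = root_of T")
      case True
      then have "z \<in> root_nbrs T"
        using step.hyps by (simp add: root_nbrs_def adj_iff)
      then show ?thesis
        using self_in_branch[of z T] by blast
    next
      case False
      then obtain c where c: "c \<in> root_nbrs T" "y \<in> verts (branch T c)"
        using step.IH by blast
      have "{y, z} \<in> edges T"
        using step.hyps by (simp add: adj_iff)
      then have "z = root_of T \<or> z \<in> verts (branch T c)"
        using branch_edge_closed[OF c(2)] False by blast
      then show ?thesis
        using c(1) by blast
    qed
  qed simp
  show "verts T - {root_of T} \<subseteq> (\<Union>c\<in>root_nbrs T. verts (branch T c))"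
  proof
    fix v
    assume v: "v \<in> verts T - {root_of T}"
    then have "(root_of T, v) \<in> (adj (edges T))\<^sup>*"
      using T by (simp add: rooted_tree_def)
    then show "v \<in> (\<Union>c\<in>root_nbrs T. verts (branch T c))"
      using reach v by blast
  qed
qed

lemma degree_root:
  assumes T: "rooted_tree T"
  shows "degree T (root_of T) = card (root_nbrs T)"
proof -
  have "{e \<in> edges T. root_of T \<in> e} = (\<lambda>c. {root_of T, c}) ` root_nbrs T"
  proof (intro equalityI subsetI)
    fix e
    assume e: "e \<in> {e \<in> edges T. root_of T \<in> e}"
    then obtain w where "e = {root_of T, w}"
      using rooted_tree_edgeE[OF T] by blast
    then show "e \<in> (\<lambda>c. {root_of T, c}) ` root_nbrs T"
      using e by (simp add: root_nbrs_def)
  qed (auto simp: root_nbrs_def)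
  moreover have "inj_on (\<lambda>c. {root_of T, c}) (root_nbrs T)"
    by (auto simp: inj_on_def doubleton_eq_iff)
  ultimately show ?thesis
    by (simp add: degree_def card_image)
qed

text \<open>An edge at \<open>v\<close> that is lost in the branch leads to the root. Then \<open>v\<close> is
  itself a neighbour of the root and lies in its own branch as well as in that of \<open>c\<close>, hence
  equals \<open>c\<close> because branches are disjoint.\<close>

lemma incident_edges_branch:
  assumes T: "rooted_tree T" and c: "c \<in> root_nbrs T" and v: "v \<in> verts (branch T c)"
  shows "{e \<in> edges T. v \<in> e} =
    {e \<in> edges (branch T c). v \<in> e} \<union> (if v = c then {{root_of T, c}} else {})"
    (is "?L = ?R")
proof
  have vr: "v \<noteq> root_of T"
    using v root_notin_branch[OF T c] by auto
  show "?L \<subseteq> ?R"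
  proof
    fix e
    assume e: "e \<in> ?L"
    then obtain w where w: "e = {v, w}"
      using rooted_tree_edgeE[OF T] by blast
    show "e \<in> ?R"
    proof (cases "w = root_of T")
      case True
      then have "v \<in> root_nbrs T"
        using e w by (simp add: root_nbrs_def insert_commute)
      then have "v = c"
        using branch_disjoint[OF T _ c self_in_branch v] by simp
      then show ?thesis
        using w True by (auto simp: insert_commute)
    next
      case False
      then have "w \<in> verts (branch T c)"
        using branch_edge_closed[OF v _ vr] e w by simp
      then show ?thesis
        using e w v by (simp add: edges_branch)
    qed
  qed
  show "?R \<subseteq> ?L"
    using c by (auto simp: edges_branch root_nbrs_def)
qed

lemma degree_branch:
  assumes T: "rooted_tree T" and c: "c \<in> root_nbrs T" and v: "v \<in> verts (branch T c)"
  shows "degree T v = degree (branch T c) v + (if v = c then 1 else 0)"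
proof -
  have "{root_of T, c} \<notin> edges (branch T c)"
    using root_notin_branch[OF T c] by (simp add: edges_branch)
  moreover have "finite {e \<in> edges (branch T c). v \<in> e}"
    using finite_edges[OF T] by (simp add: edges_branch)
  ultimately show ?thesis
    using incident_edges_branch[OF assms] by (cases "v = c") (simp_all add: degree_def)
qed

section \<open>The Zagreb index as a function of the Matula number\<close>

lemma matula_rooted_tree:
  "rooted_tree T \<Longrightarrow> matula T = (\<Prod>c\<in>root_nbrs T. nth_prime (matula (branch T c)))"
  by (simp add: matula.simps)

lemma matula_pos: "rooted_tree T \<Longrightarrow> matula T \<ge> 1"
  using prime_gt_0_nat[OF prime_nth_prime]
  by (simp add: matula_rooted_tree Suc_le_eq prod_pos)

text \<open>The defining product of the Matula number already is its factorization into primes, so the prime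
  factors, with multiplicity, correspond to the neighbours of the root. The degree of the root, as well as the
  recursion for \<open>nonroot_product\<close>, is read off from this.\<close>

lemma prime_factorization_matula:
  assumes T: "rooted_tree T"
  shows "prime_factorization (matula T) =
    image_mset (\<lambda>c. nth_prime (matula (branch T c))) (mset_set (root_nbrs T))"
proof -
  have "matula T = prod_mset (image_mset (\<lambda>c. nth_prime (matula (branch T c)))
      (mset_set (root_nbrs T)))"
    by (simp add: matula_rooted_tree[OF T] prod_unfold_prod_mset)
  then show ?thesis
    by (simp only:) (rule prime_factorization_prod_mset_primes, auto simp: prime_nth_prime)
qed

lemma degree_root_eq_Omega: "rooted_tree T \<Longrightarrow> degree T (root_of T) = Omega (matula T)"
  by (simp add: degree_root Omega_def prime_factorization_matula)

text \<open>By induction on the tree. In the branch of \<open>c\<close> the root \<open>c\<close> has the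
  degree \<open>\<Omega>(t)\<close>, where \<open>t\<close> is the Matula number of the branch, and the edge
  to the root of \<open>T\<close> adds one; for the other vertices of the branch the induction hypothesis
  applies.\<close>

lemma prod_nonroot_degrees:
  "rooted_tree T \<Longrightarrow>
    (\<Prod>v\<in>verts T - {root_of T}. (degree T v)\<^sup>2) = nonroot_product (matula T)"
proof (induction T rule: matula.induct)
  case (1 T)
  note T = \<open>rooted_tree T\<close>
  have branch: "(\<Prod>v\<in>verts (branch T c). (degree T v)\<^sup>2) =
      (Omega (matula (branch T c)) + 1)\<^sup>2 * nonroot_product (matula (branch T c))"
    if c: "c \<in> root_nbrs T" for c
  proof -
    let ?B = "branch T c"
    have B: "rooted_tree ?B"
      using T c by (rule rooted_tree_branch)
    have "finite (verts ?B)"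
      using B by (simp add: rooted_tree_def)
    then have "(\<Prod>v\<in>verts ?B. (degree T v)\<^sup>2) =
        (degree T c)\<^sup>2 * (\<Prod>v\<in>verts ?B - {c}. (degree T v)\<^sup>2)"
      using self_in_branch by (rule prod.remove)
    also have "(\<Prod>v\<in>verts ?B - {c}. (degree T v)\<^sup>2) = (\<Prod>v\<in>verts ?B - {c}. (degree ?B v)\<^sup>2)"
      using degree_branch[OF T c] by (intro prod.cong) auto
    also have "\<dots> = nonroot_product (matula ?B)"
      using "1.IH"[OF T c B] by simp
    also have "degree T c = Omega (matula ?B) + 1"
      using degree_branch[OF T c self_in_branch] degree_root_eq_Omega[OF B] by simp
    finally show ?thesis .
  qed
  have "(\<Prod>v\<in>verts T - {root_of T}. (degree T v)\<^sup>2) =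
      (\<Prod>c\<in>root_nbrs T. \<Prod>v\<in>verts (branch T c). (degree T v)\<^sup>2)"
    unfolding nonroot_verts_eq_Union_branches[OF T]
  proof (rule prod.UNION_disjoint)
    show "finite (root_nbrs T)"
      using T by (rule finite_root_nbrs)
    show "\<forall>c\<in>root_nbrs T. finite (verts (branch T c))"
      using rooted_tree_branch[OF T] by (simp add: rooted_tree_def)
    show "\<forall>c\<in>root_nbrs T. \<forall>d\<in>root_nbrs T. c \<noteq> d \<longrightarrow>
        verts (branch T c) \<inter> verts (branch T d) = {}"
      using branch_disjoint[OF T] by blast
  qed
  also have "\<dots> = (\<Prod>c\<in>root_nbrs T. (Omega (matula (branch T c)) + 1)\<^sup>2 *
      nonroot_product (matula (branch T c)))"
    by (rule prod.cong) (simp_all add: branch)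
  also have "\<dots> = (\<Prod>c\<in>root_nbrs T.
      (Omega (prime_index (nth_prime (matula (branch T c)))) + 1)\<^sup>2 *
      nonroot_product (prime_index (nth_prime (matula (branch T c)))))"
    using matula_pos[OF rooted_tree_branch[OF T]]
    by (intro prod.cong) (simp_all add: prime_index_nth_prime)
  also have "\<dots> = nonroot_product (matula T)"
    by (simp add: nonroot_product.simps[of "matula T"] prime_factorization_matula[OF T]
        prod_unfold_prod_mset image_mset.compositionality comp_def)
  finally show ?case .
qed

lemma MZ1_tree_eq:
  assumes T: "rooted_tree T"
  shows "MZ1_tree T = (Omega (matula T))\<^sup>2 * nonroot_product (matula T)"
proof -
  have "MZ1_tree T = (degree T (root_of T))\<^sup>2 * (\<Prod>v\<in>verts T - {root_of T}. (degree T v)\<^sup>2)"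
    unfolding MZ1_tree_def using T by (intro prod.remove) (auto simp: rooted_tree_def)
  then show ?thesis
    by (simp add: degree_root_eq_Omega[OF T] prod_nonroot_degrees[OF T])
qed

section \<open>Every positive integer is a Matula number\<close>

text \<open>The root of \<open>B\<close> becomes a new neighbour of the root of \<open>T\<close>. The vertex
  sets are meant to be disjoint; asking for trees that avoid a given finite set then takes the place of a
  disjoint union with renamed vertices.\<close>

definition attach :: "'v rooted_graph \<Rightarrow> 'v rooted_graph \<Rightarrow> 'v rooted_graph" where
  "attach T B = \<lparr>verts = verts T \<union> verts B,
     edges = insert {root_of T, root_of B} (edges T \<union> edges B), root_of = root_of T\<rparr>"

lemma attach_simps [simp]:
  "verts (attach T B) = verts T \<union> verts B"
  "edges (attach T B) = insert {root_of T, root_of B} (edges T \<union> edges B)"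
  "root_of (attach T B) = root_of T"
  by (simp_all add: attach_def)

lemma successively_one_side:
  assumes "successively (\<lambda>x y. {x, y} \<in> E \<union> F) vs" and "vs \<noteq> []" "hd vs \<in> A"
    and "\<Union>E \<subseteq> A" and "A \<inter> \<Union>F = {}"
  shows "set vs \<subseteq> A"
  using assms(1-3)
proof (induction vs)
  case (Cons x xs)
  show ?case
  proof (cases "xs = []")
    case False
    then have "{x, hd xs} \<in> E \<union> F"
      using Cons.prems by (simp add: successively_Cons)
    then have "hd xs \<in> A"
      using Cons.prems(3) assms(4,5) by auto
    then show ?thesis
      using Cons False by (simp add: successively_Cons)
  qed (use Cons.prems in simp)
qed simp

lemma cycle_restrict:
  assumes "cycle E vs" and "set vs \<subseteq> A" and "\<And>e. e \<in> E \<Longrightarrow> e \<subseteq> A \<Longrightarrow> e \<in> F"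
  shows "cycle F vs"
proof -
  have "vs \<noteq> []"
    using assms(1) by (auto simp: cycle_def)
  then have "{last vs, hd vs} \<in> F"
    using assms(1,2) by (intro assms(3)) (auto simp: cycle_def)
  moreover have "successively (\<lambda>u v. {u, v} \<in> F) vs"
    using assms by (auto simp: cycle_def elim!: successively_mono)
  ultimately show ?thesis
    using assms(1) by (simp add: cycle_def)
qed

context
  fixes T B :: "'v rooted_graph"
  assumes T: "rooted_tree T" and B: "rooted_tree B" and disj: "verts T \<inter> verts B = {}"
begin

lemma root_notin_other: "root_of T \<notin> verts B" "root_of B \<notin> verts T"
  using T B disj by (auto simp: rooted_tree_def)

text \<open>The two original trees are induced subgraphs: an edge of the other tree is nonempty and lies on
  the other side, and the new edge has one end on each side.\<close>

lemma attach_edge_in_left: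
  assumes "e \<in> edges (attach T B)" "e \<subseteq> verts T"
  shows "e \<in> edges T"
proof -
  have "e \<notin> edges B"
  proof
    assume "e \<in> edges B"
    then have "e \<subseteq> verts B" "card e = 2"
      using B by (auto simp: rooted_tree_def)
    then show False
      using disj assms(2) by (auto simp: card_2_iff)
  qed
  then show ?thesis
    using assms root_notin_other by auto
qed

lemma attach_edge_in_right:
  assumes "e \<in> edges (attach T B)" "e \<subseteq> verts B"
  shows "e \<in> edges B"
proof -
  have "e \<notin> edges T"
  proof
    assume "e \<in> edges T"
    then have "e \<subseteq> verts T" "card e = 2"
      using T by (auto simp: rooted_tree_def)
    then show False
      using disj assms(2) by (auto simp: card_2_iff)
  qed
  then show ?thesis
    using assms root_notin_other by auto
qed

text \<open>A cycle within one of the two trees is excluded by assumption. On a path that avoids the root of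
  \<open>T\<close> the new edge does not occur, so the path stays on one side. Therefore a cycle with vertices
  on both sides passes through the root of \<open>T\<close>, and the rest of it lies in \<open>B\<close>. But
  both ends of this rest are then joined to the root of \<open>T\<close> by the new edge, so they are both
  equal to the root of \<open>B\<close>, although the rest has at least two distinct vertices.\<close>

lemma attach_acyclic: "\<not> cycle (edges (attach T B)) vs"
proof
  assume cyc: "cycle (edges (attach T B)) vs"
  have one_side: False
    if "cycle (edges (attach T B)) ws" and "set ws \<subseteq> verts T \<or> set ws \<subseteq> verts B" for ws
    using that(2)
  proof
    assume "set ws \<subseteq> verts T"
    then have "cycle (edges T) ws"
      by (rule cycle_restrict[OF that(1) _ attach_edge_in_left])
    then show False
      using T by (auto simp: rooted_tree_def)
  next
    assume "set ws \<subseteq> verts B"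
    then have "cycle (edges B) ws"
      by (rule cycle_restrict[OF that(1) _ attach_edge_in_right])
    then show False
      using B by (auto simp: rooted_tree_def)
  qed
  have path_one_side: "set ws \<subseteq> verts T \<or> set ws \<subseteq> verts B"
    if suc: "successively (\<lambda>x y. {x, y} \<in> edges (attach T B)) ws"
      and "ws \<noteq> []" and "hd ws \<in> verts T \<union> verts B" and r: "root_of T \<notin> set ws" for ws
  proof -
    have suc': "successively (\<lambda>x y. {x, y} \<in> edges T \<union> edges B) ws"
      using suc by (rule successively_mono) (use r in \<open>auto simp: doubleton_eq_iff\<close>)
    have "set ws \<subseteq> verts T" if "hd ws \<in> verts T"
      using successively_one_side[OF suc' \<open>ws \<noteq> []\<close> that]
        Union_edges_subset[OF T] Union_edges_subset[OF B] disj by blast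
    moreover have "set ws \<subseteq> verts B" if "hd ws \<in> verts B"
      using successively_one_side[OF suc'[unfolded Un_commute[of "edges T"]] \<open>ws \<noteq> []\<close> that]
        Union_edges_subset[OF T] Union_edges_subset[OF B] disj by blast
    ultimately show ?thesis
      using that(3) by blast
  qed
  have edge_verts: "x \<in> verts T \<union> verts B"
    if "{y, x} \<in> edges (attach T B)" for x y
    using that T B Union_edges_subset[OF T] Union_edges_subset[OF B]
    by (auto simp: rooted_tree_def doubleton_eq_iff)
  show False
  proof (cases "root_of T \<in> set vs")
    case False
    have "vs \<noteq> []" "hd vs \<in> verts T \<union> verts B"
      using cyc edge_verts by (auto simp: cycle_def)
    then have "set vs \<subseteq> verts T \<or> set vs \<subseteq> verts B"
      using path_one_side cyc False by (simp add: cycle_def)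
    then show False
      using one_side cyc by blast
  next
    case True
    then obtain xs ys where "vs = xs @ root_of T # ys"
      by (meson split_list)
    then have cyc': "cycle (edges (attach T B)) (root_of T # ys @ xs)"
      using cycle_rotate[of _ xs "root_of T # ys"] cyc by simp
    define ws where "ws = ys @ xs"
    have len: "length ws \<ge> 2" and dist: "distinct ws" and r: "root_of T \<notin> set ws"
      and suc: "successively (\<lambda>x y. {x, y} \<in> edges (attach T B)) ws"
      and first: "{root_of T, hd ws} \<in> edges (attach T B)"
      and last: "{root_of T, last ws} \<in> edges (attach T B)"
      using cyc' unfolding ws_def[symmetric]
      by (auto simp: cycle_def successively_Cons insert_commute split: if_splits)
    have "ws \<noteq> []"
      using len by auto
    have "\<not> set ws \<subseteq> verts T"
      using one_side[OF cyc'] T by (auto simp: rooted_tree_def ws_def)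
    then have "set ws \<subseteq> verts B"
      using path_one_side[OF suc \<open>ws \<noteq> []\<close> edge_verts[OF first] r] by blast
    moreover have "x = root_of B"
      if "{root_of T, x} \<in> edges (attach T B)" "x \<in> verts B" for x
      using that root_notin_other disj rooted_tree_edgeD[OF T, of "root_of T" x]
        rooted_tree_edgeD[OF B, of "root_of T" x]
      by (auto simp: doubleton_eq_iff)
    ultimately have "hd ws = last ws"
      using first last \<open>ws \<noteq> []\<close> by (metis hd_in_set last_in_set subsetD)
    then show False
      using len dist by (cases ws rule: remdups_adj.cases) (auto split: if_splits)
  qed
qed

lemma attach_rooted_tree: "rooted_tree (attach T B)"
proof -
  let ?R = "(adj (edges (attach T B)))\<^sup>*"
  have bridge: "(root_of T, root_of B) \<in> ?R"
    by (rule r_into_rtrancl) (simp add: adj_iff)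
  have left: "(root_of T, v) \<in> ?R" if "v \<in> verts T" for v
  proof (rule adj_rtrancl_mono)
    show "(root_of T, v) \<in> (adj (edges T))\<^sup>*"
      using that T by (simp add: rooted_tree_def)
  qed auto
  have "(root_of B, v) \<in> ?R" if "v \<in> verts B" for v
  proof (rule adj_rtrancl_mono)
    show "(root_of B, v) \<in> (adj (edges B))\<^sup>*"
      using that B by (simp add: rooted_tree_def)
  qed auto
  then have from_root: "(root_of T, v) \<in> ?R" if "v \<in> verts (attach T B)" for v
    using that left rtrancl_trans[OF bridge] by auto
  have "(u, v) \<in> ?R" if "u \<in> verts (attach T B)" "v \<in> verts (attach T B)" for u v
    using that by (rule adj_rtrancl_from_common[OF from_root from_root])
  moreover have "root_of T \<noteq> root_of B"
    using root_notin_other B by (auto simp: rooted_tree_def)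
  ultimately show ?thesis
    using attach_acyclic T B unfolding rooted_tree_def by auto
qed

lemma root_nbrs_attach: "root_nbrs (attach T B) = insert (root_of B) (root_nbrs T)"
  using root_notin_other rooted_tree_edgeD[OF B]
  by (auto simp: root_nbrs_def doubleton_eq_iff)

lemma attached_root_notin_root_nbrs: "root_of B \<notin> root_nbrs T"
  using root_notin_other rooted_tree_edgeD[OF T] by (auto simp: root_nbrs_def)

lemma attach_edges_avoiding_root:
  "{e \<in> edges (attach T B). root_of T \<notin> e} = {e \<in> edges T. root_of T \<notin> e} \<union> edges B"
  using root_notin_other Union_edges_subset[OF B] by auto

text \<open>The old branches persist and the new one is \<open>B\<close>. These are equalities of graphs and
  not just isomorphisms, so \<open>matula\<close> can be rewritten with them.\<close>

lemma branch_attach_old: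
  assumes c: "c \<in> root_nbrs T"
  shows "branch (attach T B) c = branch T c"
proof -
  have "c \<in> verts T"
    using c rooted_tree_edgeD[OF T] by (auto simp: root_nbrs_def)
  then have "(c, v) \<in> (adj ({e \<in> edges T. root_of T \<notin> e} \<union> edges B))\<^sup>* \<longleftrightarrow>
      (c, v) \<in> (adj {e \<in> edges T. root_of T \<notin> e})\<^sup>*" for v
    using rtrancl_adj_Un_disjoint[of c v "{e \<in> edges T. root_of T \<notin> e}" "edges B" "verts T"]
      Union_edges_subset[OF T] Union_edges_subset[OF B] disj
      adj_rtrancl_mono[of "{e \<in> edges T. root_of T \<notin> e}"]
    by blast
  then have V: "verts (branch (attach T B) c) = verts (branch T c)"
    unfolding verts_branch attach_simps(3) attach_edges_avoiding_root by simp
  have "verts (branch T c) \<subseteq> verts T"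
    using verts_branch_psubset[OF T c] by simp
  then have "edges (branch (attach T B) c) = edges (branch T c)"
    using attach_edge_in_left by (auto simp: edges_branch V simp del: attach_simps(2)) auto
  then show ?thesis
    using V by simp
qed

lemma branch_attach_new: "branch (attach T B) (root_of B) = B"
proof -
  have b: "root_of B \<in> verts B"
    using B by (simp add: rooted_tree_def)
  have "(root_of B, v) \<in> (adj (edges B \<union> {e \<in> edges T. root_of T \<notin> e}))\<^sup>* \<longleftrightarrow> v \<in> verts B"
    (is "?reach \<longleftrightarrow> _") for v
  proof
    have "verts B \<inter> \<Union>{e \<in> edges T. root_of T \<notin> e} = {}"
      using Union_edges_subset[OF T] disj by blast
    then show "v \<in> verts B" if ?reach
      using rtrancl_adj_Un_disjoint[OF that b Union_edges_subset[OF B]] by simp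
    show ?reach if "v \<in> verts B"
    proof (rule adj_rtrancl_mono)
      show "(root_of B, v) \<in> (adj (edges B))\<^sup>*"
        using B b that by (simp add: rooted_tree_def)
    qed simp
  qed
  then have V: "verts (branch (attach T B) (root_of B)) = verts B"
    unfolding verts_branch attach_simps(3) attach_edges_avoiding_root by (simp add: Un_commute)
  have "edges (branch (attach T B) (root_of B)) = edges B"
    using attach_edge_in_right Union_edges_subset[OF B]
    by (auto simp: edges_branch V simp del: attach_simps(2)) auto
  then show ?thesis
    using V by simp
qed

lemma matula_attach: "matula (attach T B) = matula T * nth_prime (matula B)"
  using finite_root_nbrs[OF T] attached_root_notin_root_nbrs
  by (simp add: matula_rooted_tree[OF attach_rooted_tree] matula_rooted_tree[OF T]
      root_nbrs_attach branch_attach_new branch_attach_old mult.commute)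

end

lemma rooted_tree_single: "rooted_tree \<lparr>verts = {x}, edges = {}, root_of = x\<rparr>"
  by (auto simp: rooted_tree_def cycle_def)

lemma matula_single: "matula \<lparr>verts = {x}, edges = {}, root_of = x\<rparr> = 1"
  by (simp add: matula_rooted_tree[OF rooted_tree_single] root_nbrs_def)

text \<open>The set \<open>F\<close> of forbidden vertices strengthens the induction: it makes the second tree
  disjoint from the first one.\<close>

lemma ex_rooted_tree_matula:
  fixes F :: "'v set"
  assumes "infinite (UNIV :: 'v set)" and "n \<ge> 1" and "finite F"
  shows "\<exists>T :: 'v rooted_graph. rooted_tree T \<and> matula T = n \<and> verts T \<inter> F = {}"
  using assms(2,3)
proof (induction n arbitrary: F rule: less_induct)
  case (less n)
  show ?case
  proof (cases "n = 1")
    case True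
    obtain x where "x \<notin> F"
      using assms(1) less.prems(2) ex_new_if_finite by blast
    then show ?thesis
      using True rooted_tree_single[of x] matula_single[of x]
      by (intro exI[of _ "\<lparr>verts = {x}, edges = {}, root_of = x\<rparr>"]) simp
  next
    case False
    then obtain p where p: "prime p" "p dvd n"
      using prime_factor_nat by blast
    then obtain m where m: "n = m * p"
      by (auto simp: dvd_def mult.commute)
    obtain t where t: "t \<ge> 1" "p = nth_prime t"
      using p(1) by (rule prime_is_nth_prime)
    have "m \<ge> 1"
      using m less.prems(1) by (cases m) auto
    moreover have "m < n"
      using m \<open>m \<ge> 1\<close> prime_gt_1_nat[OF p(1)] by simp
    ultimately obtain T :: "'v rooted_graph"
      where T: "rooted_tree T" "matula T = m" "verts T \<inter> F = {}"
      using less.IH less.prems(2) by blast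
    have "t < p"
      using t less_nth_prime by simp
    also have "p \<le> n"
      using m \<open>m \<ge> 1\<close> by simp
    finally have "t < n" .
    moreover have "finite (F \<union> verts T)"
      using T(1) less.prems(2) by (simp add: rooted_tree_def)
    ultimately obtain B :: "'v rooted_graph"
      where B: "rooted_tree B" "matula B = t" "verts B \<inter> (F \<union> verts T) = {}"
      using less.IH t(1) by blast
    have disj: "verts T \<inter> verts B = {}"
      using B(3) by blast
    have "verts (attach T B) \<inter> F = {}"
      using T(3) B(3) by auto
    then show ?thesis
      using attach_rooted_tree[OF T(1) B(1) disj] matula_attach[OF T(1) B(1) disj] T(2) B(2) m t(2)
      by metis
  qed
qed

section \<open>The recursion for the first multiplicative Zagreb index\<close>

lemma MZ1_eq:
  assumes "n \<ge> 1"
  shows "MZ1 n = real ((Omega n)\<^sup>2 * nonroot_product n)"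
proof -
  have "\<exists>T :: nat rooted_graph. rooted_tree T \<and> matula T = n"
    using ex_rooted_tree_matula[OF infinite_UNIV_nat assms finite.emptyI] by blast
  then have "rooted_tree (tau n) \<and> matula (tau n) = n"
    unfolding tau_def by (rule someI_ex)
  then show ?thesis
    by (simp add: MZ1_def MZ1_tree_eq)
qed

theorem proposition3p22:
  fixes n :: nat
  assumes "n \<ge> 1"
  shows "(n = 1 \<longrightarrow> MZ1 n = 0) \<and>
    (n = 2 \<longrightarrow> MZ1 n = 1) \<and>
    (\<forall>t. t \<ge> 2 \<and> n = nth_prime t \<longrightarrow>
       MZ1 n = MZ1 t * (1 + 1 / real (Omega t))\<^sup>2) \<and>
    (\<forall>r s. r \<ge> 2 \<and> s \<ge> 2 \<and> n = r * s \<longrightarrow>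
       MZ1 n = MZ1 r * MZ1 s * (1 / real (Omega r) + 1 / real (Omega s))\<^sup>2)"
proof (intro conjI allI impI)
  assume "n = 1"
  then show "MZ1 n = 0"
    by (simp add: MZ1_eq Omega_def)
next
  assume n: "n = 2"
  have "enumerate {p::nat. prime p} 0 = 2"
    unfolding enumerate_0 by (rule Least_equality) (auto simp: prime_ge_2_nat)
  then have "n = nth_prime 1"
    using n by (simp add: nth_prime_def)
  then have "nonroot_product n = 1" "Omega n = 1"
    using nonroot_product_nth_prime[of 1] nonroot_product_1 Omega_nth_prime[of 1]
    by (simp_all add: Omega_def)
  then show "MZ1 n = 1"
    using assms by (simp add: MZ1_eq)
next
  fix t
  assume t: "t \<ge> 2 \<and> n = nth_prime t"
  then have "MZ1 n = (real (Omega t) + 1)\<^sup>2 * real (nonroot_product t)"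
    using assms by (simp add: MZ1_eq Omega_nth_prime nonroot_product_nth_prime)
  also have "\<dots> = ((real (Omega t))\<^sup>2 * real (nonroot_product t)) * (1 + 1 / real (Omega t))\<^sup>2"
    using Omega_pos[of t] t by (simp add: field_simps power2_eq_square)
  also have "(real (Omega t))\<^sup>2 * real (nonroot_product t) = MZ1 t"
    using t by (simp add: MZ1_eq)
  finally show "MZ1 n = MZ1 t * (1 + 1 / real (Omega t))\<^sup>2" .
next
  fix r s
  assume rs: "r \<ge> 2 \<and> s \<ge> 2 \<and> n = r * s"
  let ?a = "real (Omega r)" and ?b = "real (Omega s)"
  let ?P = "real (nonroot_product r)" and ?Q = "real (nonroot_product s)"
  have "MZ1 n = (?a + ?b)\<^sup>2 * (?P * ?Q)"
    using assms rs by (simp add: MZ1_eq Omega_mult nonroot_product_mult)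
  also have "\<dots> = (?a\<^sup>2 * ?P) * (?b\<^sup>2 * ?Q) * (1 / ?a + 1 / ?b)\<^sup>2"
    using Omega_pos[of r] Omega_pos[of s] rs by (simp add: field_simps power2_eq_square)
  also have "?a\<^sup>2 * ?P = MZ1 r"
    using rs by (simp add: MZ1_eq)
  also have "?b\<^sup>2 * ?Q = MZ1 s"
    using rs by (simp add: MZ1_eq)
  finally show "MZ1 n = MZ1 r * MZ1 s * (1 / ?a + 1 / ?b)\<^sup>2" .
qed

end
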